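(* Let $\kappa, r, \ell$ be nonnegative integers, let $t_1,\ldots,t_n$ be $n$ distinct points on $\mathbb{T}$, let $g\in\mathcal{B}_\ell/\mathcal{B}_r$, and let $f\in\mathcal{S}_{\le\kappa}$. Assume that for some nonnegative integers $m_1,\ldots,m_n$, $$f(z)=g(z)+o((z-t_i)^{m_i})\quad\text{as } z\in\mathbb{D} \text{ tends to } t_i \text{ nontangentially},\qquad i=1,\ldots,n.$$ If $$\left[\frac{m_1+1}{2}\right]+\ldots+\left[\frac{m_n+1}{2}\right]>\kappa+\ell,$$ then $f\equiv g$.
   Context: $\mathbb{D}$ is the open unit disk and $\mathbb{T}$ the unit circle in $\mathbb{C}$. $[x]$ denotes the largest integer not exceeding the real number $x$. $\mathcal{S}$ is the Schur class: the closed unit ball of $H^\infty(\mathbb{D})$, i.e. analytic functions on $\mathbb{D}$ bounded by one in modulus. $\mathcal{B}_k$ is the set of all finite Blaschke products of degree $k$ (a unimodular constant factor is allowed; $\mathcal{B}_0$ consists of unimodular constants). $\mathcal{B}_p/\mathcal{B}_q$ is the set of all coprime quotients $g=b/\theta$ with $b\in\mathcal{B}_p$ and $\theta\in\mathcal{B}_q$ (coprime: no common zeros in $\mathbb{D}$); equivalently, the set of all rational functions unimodular on $\mathbb{T}$ with $p$ zeros and $q$ poles in $\mathbb{D}$, counted with multiplicities. The generalized Schur class $\mathcal{S}_k$ consists of all coprime quotients $f=s/b$ with $s\in\mathcal{S}$ and $b\in\mathcal{B}_k$ (no common zeros in $\mathbb{D}$), and $\mathcal{S}_{\le\kappa}=\bigcup_{q\le\kappa}\mathcal{S}_q$,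 i.e. the set of all quotients $s/b$ with $s\in\mathcal{S}$, $b\in\mathcal{B}_\kappa$, not necessarily coprime. Functions in these classes are regarded as meromorphic functions on $\mathbb{D}$. "$z$ tends to $t$ nontangentially" means that $z\to t$ within any fixed nontangential approach region (Stolz angle) in $\mathbb{D}$ with vertex $t\in\mathbb{T}$. *)

theory Defs
  imports "HOL-Complex_Analysis.Complex_Analysis" "HOL-Library.Landau_Symbols"
begin

definition schur_class :: "(complex \<Rightarrow> complex) set" where
  "schur_class = {s. s holomorphic_on ball 0 1 \<and> (\<forall>z\<in>ball 0 1. norm (s z) \<le> 1)}"

(* Moebius_function 0 a z = (z - a) / (1 - cnj a * z).  The list of zeros may have
   repetitions, so its length is the degree. *)
definition blaschke_products :: "nat \<Rightarrow> (complex \<Rightarrow> complex) set" where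
  "blaschke_products k =
     {(\<lambda>z. c * (\<Prod>a\<leftarrow>as. Moebius_function 0 a z)) | c as.
        norm c = 1 \<and> length as = k \<and> set as \<subseteq> ball 0 1}"

(* Meromorphic functions on the unit disc are represented by functions on the complex plane
   of which only the values on the disc matter.  Since the quotient is coprime and x / 0 = 0,
   f is continuous away from its poles and 0 at its poles.  The representative is thus unique
   on the disc, and equality of meromorphic functions is pointwise equality on the disc. *)
definition coprime_quotients ::
  "(complex \<Rightarrow> complex) set \<Rightarrow> (complex \<Rightarrow> complex) set \<Rightarrow> (complex \<Rightarrow> complex) set" where
  "coprime_quotients A B =
     {f. \<exists>s\<in>A. \<exists>b\<in>B. (\<forall>z\<in>ball 0 1. \<not> (s z = 0 \<and> b z = 0)) \<and>
                     (\<forall>z\<in>ball 0 1. f z = s z / b z)}"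

definition blaschke_quotients :: "nat \<Rightarrow> nat \<Rightarrow> (complex \<Rightarrow> complex) set" where
  "blaschke_quotients p q = coprime_quotients (blaschke_products p) (blaschke_products q)"

definition gen_schur_class :: "nat \<Rightarrow> (complex \<Rightarrow> complex) set" where
  "gen_schur_class k = coprime_quotients schur_class (blaschke_products k)"

definition gen_schur_class_le :: "nat \<Rightarrow> (complex \<Rightarrow> complex) set" where
  "gen_schur_class_le k = (\<Union>q\<le>k. gen_schur_class q)"

definition stolz_angle :: "complex \<Rightarrow> real \<Rightarrow> complex set" where
  "stolz_angle t M = {z \<in> ball 0 1. norm (z - t) < M * (1 - norm z)}"

definition nontangential_smallo ::
  "complex \<Rightarrow> (complex \<Rightarrow> complex) \<Rightarrow> (complex \<Rightarrow> complex) \<Rightarrow> bool" where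
  "nontangential_smallo t h u \<longleftrightarrow> (\<forall>M>1. h \<in> o[at t within stolz_angle t M](u))"

end

theory Submission imports Defs begin

text \<open>
  Write \<open>f = s / b\<close> and \<open>g = \<beta> / \<theta>\<close>.  Then \<open>h = s * \<theta>\<close> is a Schur function, \<open>B = b * \<beta>\<close> is a
  Blaschke product of degree \<open>d \<le> \<kappa> + l\<close>, and \<open>B - h = - b * \<theta> * (f - g)\<close> is as small at the
  boundary points as \<open>f - g\<close>.  It suffices to show \<open>h = B\<close>
  (\<open>schur_eq_blaschke_if_boundary_contact\<close>), because coprimality then makes the two quotients equal.

  Suppose for a moment that \<open>h\<close> is analytic across the unit circle.  There
  \<open>Re ((B - h) * cnj B)\<close> is at least half the square of \<open>norm (B - h)\<close>.  Let \<open>k s = [(m s + 1) / 2]\<close>,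
  let \<open>e > d\<close> be the sum of the \<open>k s\<close>, and let \<open>D\<close> be the denominator of \<open>B\<close>.  The product of
  \<open>cnj B\<close> and the positive weight \<open>(norm (D z))\<^sup>2 / (\<Prod>s. norm (z - s) ^ (2 * k s))\<close> is on the circle
  a rational function: up to a constant,
  \<open>(D z)\<^sup>2 * z ^ (e - d) / (\<Prod>s. ((z - s) * (1 - cnj s * z)) ^ k s)\<close>.  Its product with
  \<open>B - h\<close> is analytic in the disc, the contact at the points \<open>s\<close> compensates the boundary
  poles, and it vanishes at 0 because \<open>e > d\<close>.  So the mean over the circle of a weighted
  \<open>Re ((B - h) * cnj B) \<ge> 0\<close> is 0, which forces \<open>h = B\<close>.

  Since only nontangential smallness is known, the nodes \<open>s\<close> are moved to \<open>\<rho> * s\<close> with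
  \<open>\<rho> < 1\<close>.  The mean is then a sum of residues at these points, each of which is an integral over a
  small circle inside a Stolz angle and tends to 0 as \<open>\<rho>\<close> tends to 1 (\<open>residue_tendsto_0\<close>).
  Since \<open>h\<close> has no values on the unit circle, the comparison of means is carried out on circles
  of radius \<open>R < 1\<close>, with an error that disappears as \<open>R\<close> tends to 1 while \<open>\<rho>\<close> is fixed
  (\<open>defect_bound_by_residues\<close>).
\<close>

section \<open>Finite Blaschke products\<close>

lemma cnj_mult_self_sphere:
  assumes "norm (z::complex) = 1" shows "cnj z * z = 1"
  using complex_norm_square[of z] assms by (simp add: mult.commute)

lemma Moebius_denominator_bound:
  assumes "norm (a::complex) < 1" "norm z \<le> 1"
  shows "norm (1 - cnj a * z) \<ge> 1 - norm a"
proof -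
  have "norm (cnj a * z) \<le> norm a * 1"
    unfolding norm_mult by (rule mult_mono) (use assms in auto)
  then show ?thesis
    using norm_triangle_ineq2[of 1 "cnj a * z"] by simp
qed

lemma blaschke_product_cases:
  assumes "B \<in> blaschke_products d"
  obtains c as where "norm c = 1" "length as = d" "set as \<subseteq> ball 0 1"
    "\<And>z. B z = c * (\<Prod>a\<leftarrow>as. Moebius_function 0 a z)"
  using assms unfolding blaschke_products_def by auto

lemma blaschke_product_mult:
  assumes "A \<in> blaschke_products p" "B \<in> blaschke_products q"
  shows "(\<lambda>z. A z * B z) \<in> blaschke_products (p + q)"
proof -
  obtain c as where A: "norm c = 1" "length as = p" "set as \<subseteq> ball 0 1"
    "\<And>z. A z = c * (\<Prod>a\<leftarrow>as. Moebius_function 0 a z)"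
    using blaschke_product_cases[OF assms(1)] by metis
  obtain c' as' where B: "norm c' = 1" "length as' = q" "set as' \<subseteq> ball 0 1"
    "\<And>z. B z = c' * (\<Prod>a\<leftarrow>as'. Moebius_function 0 a z)"
    using blaschke_product_cases[OF assms(2)] by metis
  show ?thesis
    unfolding blaschke_products_def mem_Collect_eq
    by (intro exI[of _ "c * c'"] exI[of _ "as @ as'"])
       (use A B in \<open>auto simp: norm_mult fun_eq_iff algebra_simps\<close>)
qed

lemma blaschke_product_schur:
  assumes "B \<in> blaschke_products d"
  shows "B \<in> schur_class"
proof -
  obtain c as where B: "norm c = 1" "length as = d" "set as \<subseteq> ball 0 1"
    "\<And>z. B z = c * (\<Prod>a\<leftarrow>as. Moebius_function 0 a z)"
    using blaschke_product_cases[OF assms] by metis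
  have prod: "(\<lambda>z. \<Prod>a\<leftarrow>as. Moebius_function 0 a z) holomorphic_on ball 0 1 \<and>
        (\<forall>z\<in>ball 0 1. norm (\<Prod>a\<leftarrow>as. Moebius_function 0 a z) \<le> 1)"
    using B(3)
  proof (induction as)
    case (Cons a as)
    then have a: "norm a < 1" by simp
    have "norm (Moebius_function 0 a z) \<le> 1" if "z \<in> ball 0 1" for z
      using Moebius_function_norm_lt_1[OF a, of z 0] that by simp
    with Cons show ?case
      by (auto intro!: holomorphic_on_mult Moebius_function_holomorphic a
               simp: norm_mult intro: mult_le_one)
  qed auto
  have "B = (\<lambda>z. c * (\<Prod>a\<leftarrow>as. Moebius_function 0 a z))"
    using B(4) by auto
  then show ?thesis
    using prod B(1) unfolding schur_class_def by (auto intro!: holomorphic_intros simp: norm_mult)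
qed

lemma schur_class_mult:
  "\<lbrakk>s \<in> schur_class; s' \<in> schur_class\<rbrakk> \<Longrightarrow> (\<lambda>z. s z * s' z) \<in> schur_class"
  unfolding schur_class_def by (auto intro!: holomorphic_intros mult_le_one simp: norm_mult)

text \<open>
  Write a Blaschke product as a unimodular constant times \<open>N / D\<close>, where \<open>N\<close> and \<open>D\<close> are the
  products of the factors \<open>z - a\<close> and \<open>1 - cnj a * z\<close>.  On the unit circle each factor of
  \<open>N\<close> is \<open>z\<close> times the conjugate of the corresponding factor of \<open>D\<close>, so \<open>cnj N * z ^ d = D\<close>
  there.  On the circle this replaces the conjugate of \<open>B\<close>, times a positive weight, by an
  analytic function.  The lower bound for \<open>D\<close> bounds the weight
  used later from below, uniformly in the position of its nodes.
\<close>
lemma blaschke_product_reflection: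
  assumes "B \<in> blaschke_products d"
  obtains c D \<gamma> where "norm c = 1" "D holomorphic_on UNIV" "\<gamma> > 0"
    "\<And>z. norm z \<le> 1 \<Longrightarrow> \<gamma> \<le> norm (D z)"
    "\<And>z. norm z = 1 \<Longrightarrow> cnj (B z) * cnj (D z) * z ^ d = c * D z"
    "continuous_on (cball 0 1) B"
proof -
  obtain c as where B: "norm c = 1" "length as = d" "set as \<subseteq> ball 0 1"
    "\<And>z. B z = c * (\<Prod>a\<leftarrow>as. Moebius_function 0 a z)"
    using blaschke_product_cases[OF assms] by metis
  define D where "D = (\<lambda>z. \<Prod>a\<leftarrow>as. 1 - cnj a * z)"
  define \<gamma> where "\<gamma> = (\<Prod>a\<leftarrow>as. 1 - norm a)"
  define M where "M = (\<lambda>z. \<Prod>a\<leftarrow>as. Moebius_function 0 a z)"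
  have "D holomorphic_on UNIV \<and> \<gamma> > 0 \<and> (\<forall>z. norm z \<le> 1 \<longrightarrow> \<gamma> \<le> norm (D z)) \<and>
        (\<forall>z. norm z = 1 \<longrightarrow> cnj (M z) * cnj (D z) * z ^ length as = D z) \<and>
        continuous_on (cball 0 1) M"
    using B(3) unfolding D_def \<gamma>_def M_def
  proof (induction as)
    case (Cons a as)
    then have a: "norm a < 1" by simp
    note IH = Cons.IH[OF order.trans[OF set_subset_Cons Cons.prems]]
    have den: "1 - norm a \<le> norm (1 - cnj a * z)" "1 - cnj a * z \<noteq> 0" if "norm z \<le> 1" for z
      using Moebius_denominator_bound[OF a that] a by auto
    have refl: "cnj (Moebius_function 0 a z) * cnj (1 - cnj a * z) * z = 1 - cnj a * z"
      if "norm z = 1" for z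
    proof -
      have "Moebius_function 0 a z * (1 - cnj a * z) = z - a"
        using den(2)[of z] that by (simp add: Moebius_function_simple)
      then have "cnj (Moebius_function 0 a z) * cnj (1 - cnj a * z) = cnj (z - a)"
        by (metis complex_cnj_mult)
      then have "cnj (Moebius_function 0 a z) * cnj (1 - cnj a * z) * z = cnj z * z - cnj a * z"
        by (simp only: complex_cnj_diff left_diff_distrib)
      then show ?thesis
        by (simp only: cnj_mult_self_sphere[OF that])
    qed
    show ?case
    proof (intro conjI allI impI)
      show "(\<lambda>z. \<Prod>a\<leftarrow>a # as. 1 - cnj a * z) holomorphic_on UNIV"
        using IH by (auto intro!: holomorphic_intros)
      show "0 < (\<Prod>a\<leftarrow>a # as. 1 - norm a)"
        using IH a by auto
      show "(\<Prod>a\<leftarrow>a # as. 1 - norm a) \<le> norm (\<Prod>a\<leftarrow>a # as. 1 - cnj a * z)"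
        if "norm z \<le> 1" for z
        using IH a den[OF that] that
        by (simp only: list.map prod_list.Cons norm_mult, intro mult_mono) auto
      show "cnj (\<Prod>a\<leftarrow>a # as. Moebius_function 0 a z) * cnj (\<Prod>a\<leftarrow>a # as. 1 - cnj a * z)
            * z ^ length (a # as) = (\<Prod>a\<leftarrow>a # as. 1 - cnj a * z)" if z: "norm z = 1" for z
      proof -
        have "cnj (\<Prod>a\<leftarrow>as. Moebius_function 0 a z) * cnj (\<Prod>a\<leftarrow>as. 1 - cnj a * z)
            * z ^ length as = (\<Prod>a\<leftarrow>as. 1 - cnj a * z)"
          using IH z by blast
        with refl[OF z] show ?thesis
          by (simp only: list.map prod_list.Cons complex_cnj_mult length_Cons power_Suc)
             (metis (no_types, lifting) mult.assoc mult.left_commute)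
      qed
      have "continuous_on (cball 0 1) (Moebius_function 0 a)"
        unfolding Moebius_function_simple[abs_def] by (intro continuous_intros) (use den in auto)
      then show "continuous_on (cball 0 1) (\<lambda>z. \<Prod>a\<leftarrow>a # as. Moebius_function 0 a z)"
        using IH by (auto intro!: continuous_intros)
    qed
  qed auto
  note * = this
  have BM: "B = (\<lambda>z. c * M z)"
    using B(4) unfolding M_def by auto
  show ?thesis
  proof (rule that[of "cnj c" D \<gamma>])
    show "cnj (B z) * cnj (D z) * z ^ d = cnj c * D z" if "norm z = 1" for z
      using * that B(2) unfolding BM by (metis complex_cnj_mult mult.assoc)
    show "continuous_on (cball 0 1) B"
      unfolding BM using * by (intro continuous_intros) auto
  qed (use * B(1) in auto)
qed

section \<open>Two facts about circles close to the unit circle\<close>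

text \<open>
  The mean of \<open>\<Phi>\<close> over the circle of radius \<open>R\<close> is \<open>\<sigma>\<close>, and a bound for the mean of
  the square of \<open>norm u\<close> gives one for \<open>u z0\<close> by Cauchy's formula for the square of \<open>u\<close>.
  \<open>\<Phi>\<close> may have poles inside the circle, which is why its mean enters as a contour integral.
\<close>
lemma square_bound_from_real_part_mean:
  fixes u \<Phi> :: "complex \<Rightarrow> complex"
  assumes u: "u holomorphic_on ball 0 1" and z0: "norm z0 < R" and R: "R < 1"
    and \<Phi>: "((\<lambda>z. \<Phi> z / z) has_contour_integral 2 * pi * \<i> * \<sigma>) (circlepath 0 R)"
    and bound: "\<And>z. norm z = R \<Longrightarrow> C * (norm (u z))\<^sup>2 \<le> 2 * Re (\<Phi> z) + \<eta>"
    and C: "C > 0"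
  shows "C * (norm (u z0))\<^sup>2 * (1 - norm z0 / R) \<le> 2 * Re \<sigma> + \<eta>"
proof -
  have R0: "R > 0"
    using z0 norm_ge_zero[of z0] by linarith
  define \<gamma> where "\<gamma> = circlepath 0 R"
  have vd: "vector_derivative \<gamma> (at x) = 2 * pi * \<i> * \<gamma> x" for x
    unfolding \<gamma>_def vector_derivative_circlepath by (simp add: circlepath)
  have norm\<gamma>: "norm (\<gamma> x) = R" for x
    unfolding \<gamma>_def circlepath using R0
    by (simp add: norm_mult norm_exp_eq_Re)
  have \<gamma>0: "\<gamma> x \<noteq> 0" for x
    using norm\<gamma>[of x] R0 by auto
  have "((\<lambda>x. \<Phi> (\<gamma> x) / \<gamma> x * (2 * pi * \<i> * \<gamma> x)) has_integral 2 * pi * \<i> * \<sigma>) {0..1}"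
    using \<Phi> unfolding \<gamma>_def[symmetric] has_contour_integral vd .
  from has_integral_mult_right[OF this, of "1 / (2 * pi * \<i>)"]
  have "((\<lambda>x. \<Phi> (\<gamma> x)) has_integral \<sigma>) {0..1}"
    using \<gamma>0 by (simp add: field_simps)
  then have "((\<lambda>x. Re (\<Phi> (\<gamma> x))) has_integral Re \<sigma>) {0..1}"
    by (rule has_integral_Re)
  then have "((\<lambda>x. 2 * Re (\<Phi> (\<gamma> x)) + \<eta>) has_integral 2 * Re \<sigma> + \<eta>) {0..1}"
    using has_integral_add[OF has_integral_mult_right has_integral_const_real[of \<eta> 0 1], of _ _ 2]
    by simp
  from has_integral_mult_right[OF this, of "R / (R - norm z0) / C"]
  have I1: "((\<lambda>x. R / (R - norm z0) / C * (2 * Re (\<Phi> (\<gamma> x)) + \<eta>)) has_integral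
     R / (R - norm z0) / C * (2 * Re \<sigma> + \<eta>)) {0..1}" .
  have holo: "(\<lambda>z. (u z)\<^sup>2) holomorphic_on ball 0 1"
    using u by (intro holomorphic_intros)
  have "((\<lambda>z. (u z)\<^sup>2 / (z - z0)) has_contour_integral 2 * of_real pi * \<i> * (u z0)\<^sup>2) (circlepath 0 R)"
    by (rule Cauchy_integral_circlepath_simple[OF holomorphic_on_subset[OF holo]])
       (use R z0 in auto)
  then have "((\<lambda>x. (u (\<gamma> x))\<^sup>2 / (\<gamma> x - z0) * (2 * pi * \<i> * \<gamma> x)) has_integral
      2 * of_real pi * \<i> * (u z0)\<^sup>2) {0..1}"
    unfolding \<gamma>_def[symmetric] has_contour_integral vd .
  from has_integral_mult_right[OF this, of "1 / (2 * pi * \<i>)"]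
  have I2: "((\<lambda>x. (u (\<gamma> x))\<^sup>2 * (\<gamma> x / (\<gamma> x - z0))) has_integral (u z0)\<^sup>2) {0..1}"
    by (simp add: field_simps)
  have pw: "norm ((u (\<gamma> x))\<^sup>2 * (\<gamma> x / (\<gamma> x - z0)))
       \<le> R / (R - norm z0) / C * (2 * Re (\<Phi> (\<gamma> x)) + \<eta>)" for x
  proof -
    have "R - norm z0 \<le> norm (\<gamma> x - z0)"
      using norm_triangle_ineq2[of "\<gamma> x" z0] norm\<gamma>[of x] by simp
    then have "norm (\<gamma> x / (\<gamma> x - z0)) \<le> R / (R - norm z0)"
      unfolding norm_divide norm\<gamma> using z0 R0 by (intro frac_le) auto
    moreover have "norm ((u (\<gamma> x))\<^sup>2) \<le> (2 * Re (\<Phi> (\<gamma> x)) + \<eta>) / C"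
      using bound[OF norm\<gamma>, of x] C by (simp add: norm_power field_simps)
    ultimately have "norm ((u (\<gamma> x))\<^sup>2 * (\<gamma> x / (\<gamma> x - z0)))
        \<le> (2 * Re (\<Phi> (\<gamma> x)) + \<eta>) / C * (R / (R - norm z0))"
      unfolding norm_mult by (intro mult_mono) (auto intro: order_trans[OF norm_ge_zero])
    then show ?thesis by (simp add: mult.commute)
  qed
  have "norm ((u z0)\<^sup>2) \<le> R / (R - norm z0) / C * (2 * Re \<sigma> + \<eta>)"
    using integral_norm_bound_integral[OF has_integral_integrable[OF I2] has_integral_integrable[OF I1] pw]
    unfolding integral_unique[OF I1] integral_unique[OF I2] .
  then show ?thesis
    using R0 z0 C by (simp add: norm_power field_simps)
qed

text \<open>
  A Schur function has no boundary values to begin with, so identities on the unit circle are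
  used on circles inside the disc, at the price of an error to which this lemma applies.
\<close>
lemma vanishing_on_circle_imp_small:
  fixes E :: "complex \<Rightarrow> real"
  assumes cont: "continuous_on (cball 0 1 - ball 0 r) E" and r: "r < 1"
    and zero: "\<And>z. norm z = 1 \<Longrightarrow> E z = 0" and \<eta>: "\<eta> > 0"
  obtains R0 where "r \<le> R0" "R0 < 1" "\<And>z. R0 < norm z \<Longrightarrow> norm z \<le> 1 \<Longrightarrow> E z < \<eta>"
proof -
  have "compact (cball (0::complex) 1 - ball 0 r)"
    by (intro compact_diff) auto
  then have "uniformly_continuous_on (cball 0 1 - ball 0 r) E"
    using cont compact_uniformly_continuous by blast
  then obtain \<delta> where \<delta>: "\<delta> > 0" and
    uc: "\<And>x y. \<lbrakk>x \<in> cball 0 1 - ball 0 r; y \<in> cball 0 1 - ball 0 r; dist x y < \<delta>\<rbrakk>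
            \<Longrightarrow> dist (E x) (E y) < \<eta>"
    using \<eta> unfolding uniformly_continuous_on_def by metis
  show ?thesis
  proof (rule that[of "max (max r 0) (1 - \<delta>)"])
    fix z :: complex
    assume z: "max (max r 0) (1 - \<delta>) < norm z" "norm z \<le> 1"
    have "norm (z - sgn z) = 1 - norm z"
    proof -
      have "z - sgn z = (of_real (norm z) - 1) * sgn z"
        using z r by (auto simp: sgn_eq field_simps)
      then have "norm (z - sgn z) = \<bar>norm z - 1\<bar> * norm (sgn z)"
        by (metis norm_mult norm_of_real of_real_1 of_real_diff)
      also have "norm (sgn z) = 1" using z by (auto simp: norm_sgn)
      finally show ?thesis using z(2) by simp
    qed
    then have "dist (E z) (E (sgn z)) < \<eta>"
      using z r by (intro uc) (auto simp: norm_sgn dist_norm)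
    moreover have "E (sgn z) = 0"
      using z by (intro zero) (auto simp: norm_sgn)
    ultimately show "E z < \<eta>" by (simp add: dist_real_def)
  qed (use r \<delta> in auto)
qed

section \<open>The kernel and its residues\<close>

text \<open>
  With \<open>j\<close> the total multiplicity minus the degree of the Blaschke product, this is the analytic
  function that agrees on the unit circle, up to a unimodular constant, with \<open>cnj (B z)\<close> times
  the positive weight \<open>(norm (D z))\<^sup>2 / (\<Prod>s\<in>S. norm (z - \<rho> * s) ^ (2 * k s))\<close>
  (see \<open>interpolation_kernel_on_circle\<close>).  One power of \<open>z\<close> less gives the integrand of its mean
  over a circle about 0.  The factor \<open>\<rho> < 1\<close> pulls the nodes \<open>s\<close> of the unit circle into the disc.
\<close>
definition interpolation_kernel ::
  "nat \<Rightarrow> (complex \<Rightarrow> complex) \<Rightarrow> complex set \<Rightarrow> (complex \<Rightarrow> nat) \<Rightarrow> real \<Rightarrow> complex \<Rightarrow> complex" where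
  "interpolation_kernel j D S k \<rho> z =
     (D z)\<^sup>2 * z ^ j / (\<Prod>s\<in>S. ((z - \<rho> * s) * (1 - \<rho> * cnj s * z)) ^ k s)"

text \<open>
  On the unit circle this has the same modulus as \<open>\<Prod>s\<in>S. (z - \<rho> * s) ^ k s\<close>, but it has no zeros
  in the closed disc, so that the weight can be extended continuously into the disc.
\<close>
definition reflected_nodes :: "complex set \<Rightarrow> (complex \<Rightarrow> nat) \<Rightarrow> real \<Rightarrow> complex \<Rightarrow> complex" where
  "reflected_nodes S k \<rho> z = (\<Prod>s\<in>S. (1 - \<rho> * cnj s * z) ^ k s)"

lemma reflected_factor_norm:
  assumes "norm (s::complex) = 1"
  shows "norm (1 - of_real \<rho> * cnj s * z) = norm (s - of_real \<rho> * z)"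
proof -
  have "s * (1 - of_real \<rho> * cnj s * z) = s - of_real \<rho> * (cnj s * s) * z"
    by (simp add: algebra_simps)
  also have "\<dots> = s - of_real \<rho> * z"
    using cnj_mult_self_sphere[OF assms] by simp
  finally show ?thesis
    using assms by (metis mult_1 norm_mult)
qed

lemma reflected_factor_nonzero:
  assumes "norm (s::complex) = 1" "0 < \<rho>" "\<rho> < 1" "norm z \<le> 1"
  shows "1 - of_real \<rho> * cnj s * z \<noteq> 0"
proof -
  have "1 - norm (of_real \<rho> * s) \<le> norm (1 - cnj (of_real \<rho> * s) * z)"
    using assms by (intro Moebius_denominator_bound) (auto simp: norm_mult)
  moreover have "norm (of_real \<rho> * s) < 1"
    using assms by (simp add: norm_mult)
  ultimately show ?thesis by auto
qed

lemma holomorphic_interpolation_kernel: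
  assumes "finite S" "S \<subseteq> sphere 0 1" "D holomorphic_on UNIV" "0 < \<rho>" "\<rho> < 1"
  shows "interpolation_kernel j D S k \<rho> holomorphic_on ball 0 1 - (\<lambda>s. of_real \<rho> * s) ` S"
  unfolding interpolation_kernel_def[abs_def] using assms
  by (intro holomorphic_intros holomorphic_on_subset[OF assms(3)])
     (use reflected_factor_nonzero in \<open>auto simp: subset_iff\<close>)

text \<open>
  Let \<open>\<epsilon> = 1 - \<rho>\<close>.  The circle of radius \<open>\<epsilon> / 2\<close> about \<open>\<rho> * t\<close> lies in a fixed Stolz angle
  at \<open>t\<close>, at distance of order \<open>\<epsilon>\<close> from \<open>t\<close>.  On it \<open>u\<close> is \<open>o(\<epsilon>\<^sup>m)\<close>, the two factors
  belonging to \<open>t\<close> are at least \<open>\<epsilon> / 2\<close>, and the factors of the other nodes stay away from 0.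
  As the circle has length of order \<open>\<epsilon>\<close>, the residue is \<open>o(\<epsilon> ^ (m + 1))\<close> divided by
  \<open>\<epsilon> ^ (2 * k t)\<close>, which tends to 0.  This is where the exponent \<open>[(m + 1) / 2]\<close> of the
  theorem comes from.
\<close>
lemma residue_tendsto_0:
  assumes fin: "finite S" and sph: "S \<subseteq> sphere 0 1" and t: "t \<in> S"
    and D: "D holomorphic_on UNIV"
    and u: "u holomorphic_on ball 0 1"
    and small: "nontangential_smallo t u (\<lambda>z. (z - t) ^ m)"
    and k: "2 * k t \<le> m + 1"
  shows "((\<lambda>\<rho>. residue (\<lambda>z. u z * interpolation_kernel j D S k \<rho> z) (of_real \<rho> * t)) \<longlongrightarrow> 0)
           (at_left 1)"
proof -
  have nt: "norm t = 1" using t sph by auto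
  obtain \<delta>' where \<delta>': "\<delta>' > 0" "\<And>s. s \<in> S - {t} \<Longrightarrow> \<delta>' \<le> dist t s"
    using finite_set_avoid[OF fin, of t] by auto
  define \<delta> where "\<delta> = \<delta>' / 2"
  have \<delta>: "\<delta> > 0" using \<delta>' by (simp add: \<delta>_def)
  have "compact (D ` cball 0 1)"
    by (intro compact_continuous_image holomorphic_on_imp_continuous_on
          holomorphic_on_subset[OF D]) auto
  then obtain M where M: "M > 0" "\<And>z. norm z \<le> 1 \<Longrightarrow> norm (D z) \<le> M"
    using compact_imp_bounded bounded_pos by (metis (no_types, lifting) image_eqI mem_cball_0)
  define P where "P = (\<Prod>s\<in>S-{t}. (\<delta>\<^sup>2) ^ k s)"
  have P: "P > 0" unfolding P_def using \<delta> by (intro prod_pos) auto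
  have main: "\<forall>\<^sub>F \<rho> in at_left 1. norm (residue (\<lambda>z. u z * interpolation_kernel j D S k \<rho> z)
       (of_real \<rho> * t)) \<le> \<eta> * (3 ^ m * M\<^sup>2 / P)" if \<eta>: "\<eta> > 0" for \<eta>
  proof -
    have "\<forall>\<^sub>F z in at t within stolz_angle t 4. norm (u z) \<le> \<eta> * norm ((z - t) ^ m)"
      using small \<eta> unfolding nontangential_smallo_def by (auto intro: landau_o.smallD)
    then obtain d where d: "d > 0"
      "\<And>z. \<lbrakk>z \<in> stolz_angle t 4; z \<noteq> t; dist z t < d\<rbrakk> \<Longrightarrow> norm (u z) \<le> \<eta> * norm ((z - t) ^ m)"
      unfolding eventually_at by auto
    \<comment> \<open>The three bounds keep \<open>\<rho>\<close> positive, the small circle within distance \<open>d\<close> of \<open>t\<close>, and, since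
      its points satisfy \<open>norm (t - \<rho> * z) \<le> 5/2 * \<epsilon> \<le> \<delta>' / 2\<close>, keep the factors of the other
      nodes at least \<open>\<delta>\<close>.\<close>
    define e0 where "e0 = Min {1/2, d / 2, \<delta>' / 5}"
    have e0: "e0 > 0" "e0 \<le> 1/2" "e0 \<le> d/2" "e0 \<le> \<delta>'/5"
      unfolding e0_def using d \<delta>' by auto
    have "norm (residue (\<lambda>z. u z * interpolation_kernel j D S k \<rho> z) (of_real \<rho> * t))
         \<le> \<eta> * (3 ^ m * M\<^sup>2 / P)" if \<rho>: "\<rho> > 1 - e0" "\<rho> < 1" for \<rho>
    proof -
      define \<epsilon> where "\<epsilon> = 1 - \<rho>"
      have \<epsilon>: "\<epsilon> > 0" "\<epsilon> < e0" "\<rho> = 1 - \<epsilon>" using \<rho> by (auto simp: \<epsilon>_def)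
      have \<rho>0: "0 < \<rho>" using \<rho> e0 by auto
      define f where "f = (\<lambda>z. u z * interpolation_kernel j D S k \<rho> z)"
      have near: "norm (z - t) \<le> 3/2 * \<epsilon>" "norm z \<le> 1 - \<epsilon> / 2"
         "norm (t - \<rho> * z) \<le> 5/2 * \<epsilon>" if "norm (z - \<rho> * t) \<le> \<epsilon> / 2" for z :: complex
      proof -
        have "norm (\<rho> * t - t) = \<epsilon>"
        proof -
          have "\<rho> * t - t = - (of_real \<epsilon> * t)" by (simp add: \<epsilon> algebra_simps)
          then show ?thesis using nt \<epsilon> by (simp add: norm_mult)
        qed
        then show 1: "norm (z - t) \<le> 3/2 * \<epsilon>"
          using norm_triangle_ineq[of "z - \<rho> * t" "\<rho> * t - t"] that by simp
        have "norm (\<rho> * t) = \<rho>" using nt \<rho>0 by (simp add: norm_mult)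
        then show 2: "norm z \<le> 1 - \<epsilon> / 2"
          using norm_triangle_ineq[of "z - \<rho> * t" "\<rho> * t"] that \<epsilon> by simp
        have "norm (of_real \<epsilon> * z) \<le> \<epsilon> * 1"
          unfolding norm_mult using 2 \<epsilon> by (intro mult_mono) auto
        moreover have eq: "t - \<rho> * z = (t - z) + of_real \<epsilon> * z"
          by (simp add: \<epsilon> algebra_simps)
        ultimately show "norm (t - \<rho> * z) \<le> 5/2 * \<epsilon>"
          unfolding eq using norm_triangle_ineq[of "t - z" "of_real \<epsilon> * z"] 1
          unfolding norm_minus_commute[of t z] by linarith
      qed
      have far: "\<delta> \<le> norm (z - \<rho> * s)" "\<delta> \<le> norm (s - \<rho> * z)"
        if z: "norm (z - \<rho> * t) \<le> \<epsilon> / 2" and s: "s \<in> S - {t}" for z s :: complex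
      proof -
        have ns: "norm s = 1" using s sph by auto
        have "\<delta>' \<le> norm (s - t)"
          using \<delta>'(2)[OF s] by (simp add: dist_norm norm_minus_commute)
        moreover have "5/2 * \<epsilon> \<le> \<delta>" using \<epsilon> e0 by (simp add: \<delta>_def)
        moreover have "norm (s - t) \<le> norm (s - \<rho> * z) + norm (t - \<rho> * z)"
          using norm_triangle_ineq4[of "s - \<rho> * z" "t - \<rho> * z"] by simp
        moreover have "norm (s - t) \<le> norm (z - \<rho> * s) + norm (z - t) + \<epsilon>"
        proof -
          have eq: "s - t = (z - t) - (z - \<rho> * s) + of_real \<epsilon> * s"
            by (simp add: \<epsilon> algebra_simps)
          have "norm (of_real \<epsilon> * s) = \<epsilon>"
            using ns \<epsilon> by (simp add: norm_mult)
          then show ?thesis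
            unfolding eq using norm_triangle_ineq[of "(z - t) - (z - \<rho> * s)" "of_real \<epsilon> * s"]
              norm_triangle_ineq4[of "z - t" "z - \<rho> * s"] by linarith
        qed
        ultimately show "\<delta> \<le> norm (z - \<rho> * s)" "\<delta> \<le> norm (s - \<rho> * z)"
          using near[OF z] by (simp_all add: \<delta>_def)
      qed
      define U where "U = ball 0 1 - (\<lambda>s. of_real \<rho> * s) ` (S - {t})"
      have "(f has_contour_integral 2 * pi * \<i> * residue f (\<rho> * t)) (circlepath (\<rho> * t) (\<epsilon>/2))"
      proof (rule base_residue)
        show "open U" unfolding U_def
          using fin by (intro open_Diff finite_imp_closed) auto
        show cb: "cball (of_real \<rho> * t) (\<epsilon> / 2) \<subseteq> U"
        proof
          fix z assume "z \<in> cball (of_real \<rho> * t) (\<epsilon> / 2)"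
          then have z: "norm (z - \<rho> * t) \<le> \<epsilon> / 2" by (simp add: dist_norm norm_minus_commute)
          show "z \<in> U" unfolding U_def using near[OF z] far(1)[OF z] \<delta> \<epsilon> by force
        qed
        show "of_real \<rho> * t \<in> U" using cb \<epsilon> by auto
        show "f holomorphic_on U - {of_real \<rho> * t}"
          unfolding f_def U_def using \<rho>0 \<rho>
          by (intro holomorphic_on_mult holomorphic_on_subset[OF u]
               holomorphic_on_subset[OF holomorphic_interpolation_kernel[OF fin sph D]]) auto
      qed (use \<epsilon> in auto)
      moreover have "norm (f z) \<le> \<eta> * (3 ^ m * M\<^sup>2 / P) / (\<epsilon> / 2)"
        if z: "norm (z - \<rho> * t) = \<epsilon> / 2" for z :: complex
      proof -
        have z': "norm (z - \<rho> * t) \<le> \<epsilon> / 2" using z by simp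
        note nz = near[OF z']
        have nz1: "norm z < 1" using nz \<epsilon> by auto
        have "norm (u z) \<le> \<eta> * norm ((z - t) ^ m)"
        proof (rule d(2))
          \<comment> \<open>The aperture 4 works because \<open>norm (z - t) \<le> 3/2 * \<epsilon>\<close> and \<open>1 - norm z \<ge> \<epsilon> / 2\<close>.\<close>
          show "z \<in> stolz_angle t 4" unfolding stolz_angle_def using nz nz1 \<epsilon> by auto
          show "z \<noteq> t" using nz1 nt by auto
          show "dist z t < d" using nz e0 \<epsilon> by (simp add: dist_norm)
        qed
        also have "norm ((z - t) ^ m) \<le> (3/2 * \<epsilon>) ^ m"
          unfolding norm_power using nz by (intro power_mono) auto
        finally have uz: "norm (u z) \<le> \<eta> * (3/2 * \<epsilon>) ^ m" using \<eta> by simp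
        have num: "norm ((D z)\<^sup>2 * z ^ j) \<le> M\<^sup>2"
        proof -
          have "norm ((D z)\<^sup>2) \<le> M\<^sup>2" unfolding norm_power using M nz1 by (intro power_mono) auto
          moreover have "norm (z ^ j) \<le> 1" unfolding norm_power using nz1 by (intro power_le_one) auto
          ultimately have "norm ((D z)\<^sup>2) * norm (z ^ j) \<le> M\<^sup>2 * 1"
            by (intro mult_mono) auto
          then show ?thesis by (simp add: norm_mult)
        qed
        have "(\<epsilon>/2) ^ (2 * k t) * P \<le>
           norm (((z - \<rho> * t) * (1 - \<rho> * cnj t * z)) ^ k t) *
           (\<Prod>s\<in>S-{t}. norm (((z - \<rho> * s) * (1 - \<rho> * cnj s * z)) ^ k s))"
        proof (rule mult_mono)
          have "1 - norm (of_real \<rho> * t) \<le> norm (1 - cnj (of_real \<rho> * t) * z)"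
            using nz1 nt \<rho> \<rho>0 by (intro Moebius_denominator_bound) (auto simp: norm_mult)
          moreover have "norm (of_real \<rho> * t) = \<rho>"
            using nt \<rho>0 by (simp add: norm_mult)
          ultimately have "\<epsilon> / 2 \<le> norm (1 - \<rho> * cnj t * z)"
            using \<epsilon> by simp
          then have "(\<epsilon>/2) * (\<epsilon>/2) \<le> norm ((z - \<rho> * t) * (1 - \<rho> * cnj t * z))"
            unfolding norm_mult[of "z - \<rho> * t"] z using \<epsilon> by (intro mult_left_mono) auto
          then show "(\<epsilon>/2) ^ (2 * k t) \<le> norm (((z - \<rho> * t) * (1 - \<rho> * cnj t * z)) ^ k t)"
            unfolding norm_power power_mult using \<epsilon>
            by (intro power_mono) (auto simp: power2_eq_square)
          show "P \<le> (\<Prod>s\<in>S-{t}. norm (((z - \<rho> * s) * (1 - \<rho> * cnj s * z)) ^ k s))"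
            unfolding P_def
          proof (rule prod_mono, intro conjI)
            fix s assume s: "s \<in> S - {t}"
            have "norm s = 1" using s sph by auto
            then have "\<delta> * \<delta> \<le> norm ((z - \<rho> * s) * (1 - \<rho> * cnj s * z))"
              unfolding norm_mult[of "z - \<rho> * s"] using far[OF z' s] \<delta>
              by (simp only: reflected_factor_norm, intro mult_mono) auto
            then show "(\<delta>\<^sup>2) ^ k s \<le> norm (((z - \<rho> * s) * (1 - \<rho> * cnj s * z)) ^ k s)"
              unfolding norm_power by (intro power_mono) (auto simp: power2_eq_square)
          qed simp
        qed (use P in auto)
        also have "\<dots> = norm (\<Prod>s\<in>S. ((z - \<rho> * s) * (1 - \<rho> * cnj s * z)) ^ k s)"
          unfolding prod_norm prod.remove[OF fin t] norm_mult ..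
        finally have den: "(\<epsilon>/2) ^ (2 * k t) * P \<le>
             norm (\<Prod>s\<in>S. ((z - \<rho> * s) * (1 - \<rho> * cnj s * z)) ^ k s)" .
        have "norm (f z) \<le> \<eta> * (3/2 * \<epsilon>) ^ m * (M\<^sup>2 / ((\<epsilon>/2) ^ (2 * k t) * P))"
          unfolding f_def interpolation_kernel_def norm_mult[of "u z"] norm_divide
          using uz num den \<epsilon> P \<eta> by (intro mult_mono frac_le) auto
        also have "\<dots> = \<eta> * (3 ^ m * M\<^sup>2 / P) * ((\<epsilon>/2) ^ m / (\<epsilon>/2) ^ (2 * k t))"
        proof -
          have "(3/2 * \<epsilon>) ^ m = 3 ^ m * (\<epsilon>/2) ^ m"
            by (simp flip: power_mult_distrib)
          then show ?thesis by (simp add: ac_simps)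
        qed
        also have "\<dots> \<le> \<eta> * (3 ^ m * M\<^sup>2 / P) * (1 / (\<epsilon>/2))"
        proof (rule mult_left_mono)
          have "(\<epsilon>/2) ^ (m + 1) \<le> (\<epsilon>/2) ^ (2 * k t)"
            using k \<epsilon> e0 by (intro power_decreasing) auto
          moreover have "(\<epsilon>/2) ^ (2 * k t) > 0" "\<epsilon>/2 > 0" using \<epsilon> by auto
          ultimately show "(\<epsilon>/2) ^ m / (\<epsilon>/2) ^ (2 * k t) \<le> 1 / (\<epsilon>/2)"
            by (simp only: power_add power_one_right) (simp add: field_simps del: power_divide)
        qed (use \<eta> P in auto)
        finally show ?thesis
          by simp
      qed
      ultimately have "norm (2 * pi * \<i> * residue f (\<rho> * t)) \<le>
          \<eta> * (3 ^ m * M\<^sup>2 / P) / (\<epsilon> / 2) * (2 * pi * (\<epsilon>/2))"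
        using \<eta> P \<epsilon> by (intro has_contour_integral_bound_circlepath) auto
      then have "(2 * pi) * norm (residue f (\<rho> * t)) \<le> (2 * pi) * (\<eta> * (3 ^ m * M\<^sup>2 / P))"
        using \<open>\<epsilon> > 0\<close> by (simp add: norm_mult ac_simps)
      then show ?thesis
        unfolding f_def[symmetric] by (rule mult_left_le_imp_le) simp
    qed
    moreover have "\<forall>\<^sub>F \<rho> in at_left (1::real). \<rho> > 1 - e0 \<and> \<rho> < 1"
      using e0 eventually_at_left_real[of "1 - e0" 1] by (auto elim: eventually_mono)
    ultimately show ?thesis by (auto elim: eventually_mono)
  qed
  show ?thesis
  proof (rule tendstoI)
    fix e :: real assume e: "e > 0"
    define K where "K = 3 ^ m * M\<^sup>2 / P"
    have K: "K > 0" unfolding K_def using M P by simp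
    then have "e / (2 * K) * K < e" using e by simp
    with main[of "e / (2 * K)"] e K
    show "\<forall>\<^sub>F \<rho> in at_left 1. dist (residue (\<lambda>z. u z * interpolation_kernel j D S k \<rho> z)
        (of_real \<rho> * t)) 0 < e"
      unfolding K_def[symmetric] by (auto elim!: eventually_mono)
  qed
qed

section \<open>Schur functions in high contact with a finite Blaschke product\<close>

text \<open>
  Here \<open>b\<close> stands for the conjugate of the value of the Blaschke product, and the hypothesis on
  it is the reflection property proved above.  The nodes satisfy the same reflection:
  \<open>z - \<rho> * s = z * cnj (1 - \<rho> * cnj s * z)\<close> on the unit circle.
\<close>
lemma interpolation_kernel_on_circle:
  assumes z: "norm z = 1" and d: "d \<le> (\<Sum>s\<in>S. k s)"
    and refl: "b * cnj (D z) * z ^ d = c * D z"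
  shows "c * interpolation_kernel ((\<Sum>s\<in>S. k s) - d) D S k \<rho> z =
         b * of_real ((norm (D z))\<^sup>2 / (norm (reflected_nodes S k \<rho> z))\<^sup>2)"
proof -
  define e where "e = (\<Sum>s\<in>S. k s)"
  define q where "q = reflected_nodes S k \<rho> z"
  have z0: "z \<noteq> 0" using z by auto
  have "(\<Prod>s\<in>S. ((z - \<rho> * s) * (1 - \<rho> * cnj s * z)) ^ k s) = z ^ e * cnj q * q"
  proof -
    have "z - \<rho> * s = z * cnj (1 - \<rho> * cnj s * z)" for s :: complex
      using cnj_mult_self_sphere[OF z] by (simp add: algebra_simps)
    then show ?thesis
      by (simp only: q_def e_def reflected_nodes_def power_sum cnj_prod complex_cnj_power
           power_mult_distrib prod.distrib)
  qed
  then have "c * interpolation_kernel (e - d) D S k \<rho> z =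
      (c * D z) * D z * z ^ (e - d) / (z ^ e * cnj q * q)"
    by (simp add: interpolation_kernel_def power2_eq_square)
  also have "\<dots> = b * (D z * cnj (D z)) * (z ^ d * z ^ (e - d)) / (z ^ e * (q * cnj q))"
    unfolding refl[symmetric] by (simp add: ac_simps)
  also have "z ^ d * z ^ (e - d) = z ^ e"
    using d by (simp add: e_def flip: power_add)
  also have "b * (D z * cnj (D z)) * z ^ e / (z ^ e * (q * cnj q)) =
      b * ((D z * cnj (D z)) / (q * cnj q))"
    using z0 by simp
  also have "\<dots> = b * of_real ((norm (D z))\<^sup>2 / (norm q)\<^sup>2)"
    by (simp flip: complex_norm_square)
  finally show ?thesis unfolding e_def q_def .
qed

text \<open>
  For \<open>norm h \<le> 1\<close> and \<open>norm B = 1\<close> one has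
  \<open>(norm (B - h))\<^sup>2 \<le> 2 * Re ((B - h) * cnj B)\<close>.  Multiplied by the weight, the right-hand side
  becomes, on the unit circle, twice the real part of \<open>B - h\<close> times an analytic kernel.  The mean of
  that product over a circle about 0 is the sum of the residues of the product divided by \<open>z\<close>.  These
  come from the points \<open>\<rho> * s\<close> alone: there is no pole at 0, because the total multiplicity
  of the nodes exceeds the degree of \<open>B\<close>.  The constant on the left-hand side is independent of \<open>\<rho>\<close>, which permits the limit
  \<open>\<rho> \<longlonglongrightarrow> 1\<close> afterwards.
\<close>
lemma defect_bound_by_residues:
  fixes S :: "complex set" and k :: "complex \<Rightarrow> nat"
  assumes fin: "finite S" and sph: "S \<subseteq> sphere 0 1"
    and h: "h \<in> schur_class" and B: "B \<in> schur_class"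
    and contB: "continuous_on (cball 0 1) B"
    and B1: "\<And>z. norm z = 1 \<Longrightarrow> norm (B z) = 1"
    and D: "D holomorphic_on UNIV" and \<gamma>: "\<gamma> > 0" "\<And>z. norm z \<le> 1 \<Longrightarrow> \<gamma> \<le> norm (D z)"
    and refl: "\<And>z. norm z = 1 \<Longrightarrow> cnj (B z) * cnj (D z) * z ^ d = c * D z"
    and d: "d < (\<Sum>s\<in>S. k s)" and \<rho>: "0 < \<rho>" "\<rho> < 1" and z0: "norm z0 < 1"
  shows "\<gamma>\<^sup>2 / (2 ^ (\<Sum>s\<in>S. k s))\<^sup>2 * (norm (B z0 - h z0))\<^sup>2 * (1 - norm z0) \<le>
         2 * Re (c * (\<Sum>s\<in>S. residue (\<lambda>z. (B z - h z) *
                   interpolation_kernel ((\<Sum>s\<in>S. k s) - d - 1) D S k \<rho> z) (\<rho> * s)))"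
proof -
  define e where "e = (\<Sum>s\<in>S. k s)"
  define u where "u = (\<lambda>z. B z - h z)"
  define F where "F = (\<lambda>z. u z * interpolation_kernel (e - d - 1) D S k \<rho> z)"
  define A where "A = (\<lambda>z. c * interpolation_kernel (e - d) D S k \<rho> z)"
  define Q where "Q = reflected_nodes S k \<rho>"
  define w where "w = (\<lambda>z. (norm (D z))\<^sup>2 / (norm (Q z))\<^sup>2)"
  \<comment> \<open>The error caused by working inside the disc: it vanishes on the unit circle.  The factor 4 is
    the bound 2 for \<open>norm u\<close> times the 2 in front of the real part.\<close>
  define E where "E = (\<lambda>z. 4 * norm (A z - cnj (B z) * of_real (w z)) + w z * (1 - (norm (B z))\<^sup>2))"
  define C where "C = \<gamma>\<^sup>2 / (2 ^ e)\<^sup>2"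
  define P where "P = (\<lambda>s. of_real \<rho> * s) ` S"
  define \<sigma> where "\<sigma> = c * (\<Sum>p\<in>P. residue F p)"
  have C: "C > 0" using \<gamma> by (simp add: C_def)
  have injP: "inj_on (\<lambda>s. complex_of_real \<rho> * s) S" using \<rho> by (auto simp: inj_on_def)
  have finP: "finite P" using fin by (simp add: P_def)
  have normP: "norm p = \<rho>" if "p \<in> P" for p
    using that sph \<rho> by (auto simp: P_def norm_mult)
  have fac: "1 - of_real \<rho> * cnj s * z \<noteq> 0" if "s \<in> S" "norm z \<le> 1" for s z
    using reflected_factor_nonzero[of s \<rho> z] that sph \<rho> by auto
  have Q0: "Q z \<noteq> 0" if "norm z \<le> 1" for z
    unfolding Q_def reflected_nodes_def using fin fac[OF _ that] by simp
  have Qle: "norm (Q z) \<le> 2 ^ e" if z: "norm z \<le> 1" for z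
  proof -
    have "norm (Q z) = (\<Prod>s\<in>S. norm ((1 - \<rho> * cnj s * z) ^ k s))"
      by (simp add: Q_def reflected_nodes_def prod_norm)
    also have "\<dots> \<le> (\<Prod>s\<in>S. 2 ^ k s)"
    proof (intro prod_mono conjI)
      fix s assume "s \<in> S"
      then have "norm s = 1" using sph by auto
      then have "norm (\<rho> * cnj s * z) \<le> 1"
        using \<rho> z by (simp add: norm_mult mult_le_one)
      then have "norm (1 - \<rho> * cnj s * z) \<le> 2"
        using norm_triangle_ineq4[of 1 "\<rho> * cnj s * z"] by simp
      then show "norm ((1 - \<rho> * cnj s * z) ^ k s) \<le> 2 ^ k s"
        unfolding norm_power by (intro power_mono) auto
    qed simp
    finally show ?thesis by (simp add: e_def power_sum)
  qed
  have wC: "C \<le> w z" if "norm z \<le> 1" for z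
    unfolding C_def w_def using \<gamma> Qle[OF that] Q0[OF that] that
    by (intro frac_le power_mono) auto
  have uholo: "u holomorphic_on ball 0 1"
    using h B unfolding u_def schur_class_def by (auto intro: holomorphic_intros)
  have Fholo: "F holomorphic_on ball 0 1 - P"
    unfolding F_def P_def using \<rho>
    by (intro holomorphic_on_mult holomorphic_on_subset[OF uholo]
          holomorphic_interpolation_kernel fin sph D) auto
  have contour: "((\<lambda>z. u z * A z / z) has_contour_integral 2 * pi * \<i> * \<sigma>) (circlepath 0 R)"
    if R: "\<rho> < R" "R < 1" for R
  proof -
    have R0: "R > 0" using R \<rho> by simp
    have sub: "path_image (circlepath 0 R) \<subseteq> ball 0 1 - P"
      using R R0 normP by auto
    have "contour_integral (circlepath 0 R) F =
        2 * pi * \<i> * (\<Sum>p\<in>P. winding_number (circlepath 0 R) p * residue F p)"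
    proof (rule Residue_theorem)
      show "\<forall>z. z \<notin> ball 0 1 \<longrightarrow> winding_number (circlepath 0 R) z = 0"
        using R R0 by (intro allI impI winding_number_zero_outside[of _ "cball 0 R"]) auto
    qed (use finP Fholo sub in auto)
    also have "(\<Sum>p\<in>P. winding_number (circlepath 0 R) p * residue F p) = (\<Sum>p\<in>P. residue F p)"
      using R normP by (intro sum.cong) (auto simp: winding_number_circlepath)
    finally have 1: "contour_integral (circlepath 0 R) F = 2 * pi * \<i> * (\<Sum>p\<in>P. residue F p)" .
    have "F contour_integrable_on circlepath 0 R"
      using sub finP
      by (intro contour_integrable_holomorphic_simple[OF Fholo])
         (auto intro!: open_Diff finite_imp_closed)
    then have "(F has_contour_integral 2 * pi * \<i> * (\<Sum>p\<in>P. residue F p)) (circlepath 0 R)"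
      using 1 has_contour_integral_integral by metis
    then have "((\<lambda>z. c * F z) has_contour_integral c * (2 * pi * \<i> * (\<Sum>p\<in>P. residue F p)))
        (circlepath 0 R)"
      by (rule has_contour_integral_lmul)
    then have "((\<lambda>z. c * F z) has_contour_integral 2 * pi * \<i> * \<sigma>) (circlepath 0 R)"
      by (simp add: \<sigma>_def ac_simps)
    then show ?thesis
    proof (rule has_contour_integral_eq)
      fix z assume "z \<in> path_image (circlepath 0 R)"
      then have "z \<noteq> 0" using R0 by auto
      moreover have "e - d = Suc (e - d - 1)" using d by (simp add: e_def)
      then have "z ^ (e - d) = z * z ^ (e - d - 1)" by (metis power_Suc)
      ultimately show "c * F z = u z * A z / z"
        unfolding A_def F_def interpolation_kernel_def by simp
    qed
  qed
  have pointwise: "C * (norm (u z))\<^sup>2 \<le> 2 * Re (u z * A z) + E z" if z: "norm z < 1" for z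
  proof -
    define y where "y = A z - cnj (B z) * of_real (w z)"
    have hB: "norm (h z) \<le> 1" "norm (B z) \<le> 1"
      using h B z by (auto simp: schur_class_def)
    have "norm (u z) \<le> 2"
      using norm_triangle_ineq4[of "B z" "h z"] hB by (simp add: u_def)
    then have "norm (u z * y) \<le> 2 * norm y"
      unfolding norm_mult by (intro mult_right_mono) auto
    then have y: "- 2 * norm y \<le> Re (u z * y)"
      using abs_Re_le_cmod[of "u z * y"] by linarith
    have "(norm (u z))\<^sup>2 = 2 * Re (u z * cnj (B z)) + (norm (h z))\<^sup>2 - (norm (B z))\<^sup>2"
      unfolding u_def cmod_power2 by (simp add: power2_eq_square algebra_simps)
    moreover have "(norm (h z))\<^sup>2 \<le> 1"
      using hB by (simp add: power_le_one)
    ultimately have "(norm (u z))\<^sup>2 \<le> 2 * Re (u z * cnj (B z)) + (1 - (norm (B z))\<^sup>2)"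
      by simp
    then have "w z * (norm (u z))\<^sup>2 \<le> w z * (2 * Re (u z * cnj (B z)) + (1 - (norm (B z))\<^sup>2))"
      using C wC[of z] z by (intro mult_left_mono) auto
    also have "\<dots> = 2 * Re (u z * (cnj (B z) * of_real (w z))) + w z * (1 - (norm (B z))\<^sup>2)"
      by (simp add: algebra_simps)
    also have "u z * (cnj (B z) * of_real (w z)) = u z * A z - u z * y"
      by (simp add: y_def algebra_simps)
    finally have "w z * (norm (u z))\<^sup>2 \<le> 2 * Re (u z * A z) + E z"
      using y unfolding E_def y_def[symmetric] by simp
    moreover have "C * (norm (u z))\<^sup>2 \<le> w z * (norm (u z))\<^sup>2"
      using wC[of z] z by (intro mult_right_mono) auto
    ultimately show ?thesis by linarith
  qed
  \<comment> \<open>A closed annulus up to the unit circle that avoids the poles, all of modulus \<open>\<rho>\<close>.\<close>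
  define r where "r = (1 + \<rho>) / 2"
  have r: "\<rho> < r" "r < 1" using \<rho> by (auto simp: r_def)
  have contE: "continuous_on (cball 0 1 - ball 0 r) E"
  proof -
    have cD: "continuous_on T D" for T
      using D holomorphic_on_imp_continuous_on holomorphic_on_subset by blast
    have "continuous_on (cball 0 1 - ball 0 r) A"
      unfolding A_def interpolation_kernel_def
    proof (intro continuous_intros cD ballI)
      fix z :: complex assume z: "z \<in> cball 0 1 - ball 0 r"
      have "z \<noteq> of_real \<rho> * s" if "s \<in> S" for s
      proof -
        have "norm (of_real \<rho> * s) = \<rho>"
          using that by (intro normP) (auto simp: P_def)
        then show ?thesis using z r by auto
      qed
      then show "(\<Prod>s\<in>S. ((z - \<rho> * s) * (1 - \<rho> * cnj s * z)) ^ k s) \<noteq> 0"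
        using fac z fin by auto
    qed
    moreover have "continuous_on (cball 0 1 - ball 0 r) w"
      unfolding w_def
    proof (intro continuous_intros cD ballI)
      show "continuous_on (cball 0 1 - ball 0 r) Q"
        unfolding Q_def reflected_nodes_def by (intro continuous_intros)
    qed (use Q0 in auto)
    moreover have "continuous_on (cball 0 1 - ball 0 r) B"
      using contB by (rule continuous_on_subset) auto
    ultimately show ?thesis
      unfolding E_def by (intro continuous_intros)
  qed
  have zeroE: "E z = 0" if z: "norm z = 1" for z
  proof -
    have "A z = cnj (B z) * of_real (w z)"
      unfolding A_def w_def e_def Q_def
      by (rule interpolation_kernel_on_circle)
         (use z d refl in auto)
    then show ?thesis using B1[OF z] by (simp add: E_def)
  qed
  have "C * (norm (u z0))\<^sup>2 * (1 - norm z0) \<le> 2 * Re \<sigma>"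
  proof (rule field_le_epsilon)
    fix \<eta> :: real assume \<eta>: "\<eta> > 0"
    obtain R0 where R0: "r \<le> R0" "R0 < 1" "\<And>z. R0 < norm z \<Longrightarrow> norm z \<le> 1 \<Longrightarrow> E z < \<eta>"
      using vanishing_on_circle_imp_small[OF contE r(2) zeroE \<eta>] by metis
    define R1 where "R1 = max R0 (norm z0)"
    have R1: "R1 < 1" using R0 z0 by (simp add: R1_def)
    show "C * (norm (u z0))\<^sup>2 * (1 - norm z0) \<le> 2 * Re \<sigma> + \<eta>"
    proof (rule tendsto_upperbound)
      show "((\<lambda>R. C * (norm (u z0))\<^sup>2 * (1 - norm z0 / R)) \<longlongrightarrow>
             C * (norm (u z0))\<^sup>2 * (1 - norm z0)) (at_left 1)"
        by (auto intro!: tendsto_eq_intros)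
      have "C * (norm (u z0))\<^sup>2 * (1 - norm z0 / R) \<le> 2 * Re \<sigma> + \<eta>"
        if R: "R1 < R" "R < 1" for R
      proof (rule square_bound_from_real_part_mean[OF uholo _ R(2) contour])
        show "C * (norm (u z))\<^sup>2 \<le> 2 * Re (u z * A z) + \<eta>" if "norm z = R" for z
          using pointwise[of z] R0(3)[of z] that R by (simp add: R1_def)
      qed (use R R0 r C in \<open>auto simp: R1_def\<close>)
      then show "\<forall>\<^sub>F R in at_left 1. C * (norm (u z0))\<^sup>2 * (1 - norm z0 / R) \<le> 2 * Re \<sigma> + \<eta>"
        using eventually_at_left_real[OF R1] by (auto elim!: eventually_mono)
    qed simp
  qed
  also have "\<sigma> = c * (\<Sum>s\<in>S. residue F (\<rho> * s))"
    unfolding \<sigma>_def P_def by (simp add: sum.reindex[OF injP])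
  finally show ?thesis
    unfolding C_def u_def F_def e_def .
qed

text \<open>
  A boundary uniqueness theorem in the style of Burns and Krantz.  With the largest
  multiplicities that the contact permits, all residues in the preceding bound disappear as the
  nodes move to the unit circle.
\<close>
lemma schur_eq_blaschke_if_boundary_contact:
  fixes S :: "complex set" and m :: "complex \<Rightarrow> nat"
  assumes fin: "finite S" and sph: "S \<subseteq> sphere 0 1"
    and h: "h \<in> schur_class" and B: "B \<in> blaschke_products d"
    and contact: "\<And>s. s \<in> S \<Longrightarrow> nontangential_smallo s (\<lambda>z. B z - h z) (\<lambda>z. (z - s) ^ m s)"
    and d: "d < (\<Sum>s\<in>S. (m s + 1) div 2)" and z0: "norm z0 < 1"
  shows "h z0 = B z0"
proof -
  define k where "k = (\<lambda>s. (m s + 1) div 2)"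
  obtain c D \<gamma> where D: "norm c = 1" "D holomorphic_on UNIV" "\<gamma> > 0"
    "\<And>z. norm z \<le> 1 \<Longrightarrow> \<gamma> \<le> norm (D z)"
    "\<And>z. norm z = 1 \<Longrightarrow> cnj (B z) * cnj (D z) * z ^ d = c * D z"
    "continuous_on (cball 0 1) B"
    using blaschke_product_reflection[OF B] by metis
  have B1: "norm (B z) = 1" if z: "norm z = 1" for z
  proof -
    have "norm (cnj (B z) * cnj (D z) * z ^ d) = norm (c * D z)"
      using D(5)[OF z] by simp
    moreover have "norm (D z) > 0" using D(3) D(4)[of z] z by linarith
    ultimately show ?thesis using z D(1) by (simp add: norm_mult norm_power)
  qed
  note BS = blaschke_product_schur[OF B]
  have u: "(\<lambda>z. B z - h z) holomorphic_on ball 0 1"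
    using h BS unfolding schur_class_def by (auto intro: holomorphic_intros)
  define C where "C = \<gamma>\<^sup>2 / (2 ^ (\<Sum>s\<in>S. k s))\<^sup>2"
  define res where "res = (\<lambda>\<rho>. 2 * Re (c * (\<Sum>s\<in>S. residue (\<lambda>z. (B z - h z) *
       interpolation_kernel ((\<Sum>s\<in>S. k s) - d - 1) D S k \<rho> z) (of_real \<rho> * s))))"
  have "((\<lambda>\<rho>. residue (\<lambda>z. (B z - h z) * interpolation_kernel j D S k \<rho> z) (of_real \<rho> * s))
      \<longlongrightarrow> 0) (at_left 1)" if "s \<in> S" for s j
    by (rule residue_tendsto_0[OF fin sph that D(2) u contact[OF that]]) (simp add: k_def)
  then have "(res \<longlongrightarrow> 2 * Re (c * (\<Sum>s\<in>S. 0))) (at_left 1)"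
    unfolding res_def by (intro tendsto_intros)
  then have "(res \<longlongrightarrow> 0) (at_left 1)" by simp
  moreover have "\<forall>\<^sub>F \<rho> in at_left 1. C * (norm (B z0 - h z0))\<^sup>2 * (1 - norm z0) \<le> res \<rho>"
  proof (rule eventually_mono[OF eventually_at_left_real[of 0 1]])
    fix \<rho> :: real assume "\<rho> \<in> {0<..<1}"
    then show "C * (norm (B z0 - h z0))\<^sup>2 * (1 - norm z0) \<le> res \<rho>"
      unfolding C_def res_def
      using defect_bound_by_residues[OF fin sph h BS D(6) B1 D(2,3,4,5) _ _ _ z0, of k \<rho>] d
      by (simp add: k_def)
  qed simp
  ultimately have "C * (norm (B z0 - h z0))\<^sup>2 * (1 - norm z0) \<le> 0"
    by (intro tendsto_lowerbound) auto
  moreover have "C > 0" using D(3) by (simp add: C_def)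
  ultimately show ?thesis
    using z0 by (simp add: mult_le_0_iff)
qed

section \<open>Uniqueness for quotients\<close>

theorem theorem2p1:
  fixes \<kappa> r l n :: nat
    and t :: "nat \<Rightarrow> complex" and m :: "nat \<Rightarrow> nat"
    and f g :: "complex \<Rightarrow> complex"
  assumes "\<And>i. i \<in> {1..n} \<Longrightarrow> t i \<in> sphere 0 1"
    and "inj_on t {1..n}"
    and "g \<in> blaschke_quotients l r"
    and "f \<in> gen_schur_class_le \<kappa>"
    and "\<And>i. i \<in> {1..n} \<Longrightarrow>
           nontangential_smallo (t i) (\<lambda>z. f z - g z) (\<lambda>z. (z - t i) ^ m i)"
    and "(\<Sum>i=1..n. (m i + 1) div 2) > \<kappa> + l"
  shows "\<forall>z\<in>ball 0 1. f z = g z"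
proof -
  obtain \<beta> \<theta> where \<beta>: "\<beta> \<in> blaschke_products l" and \<theta>: "\<theta> \<in> blaschke_products r"
    and g_coprime: "\<And>z. z \<in> ball 0 1 \<Longrightarrow> \<not> (\<beta> z = 0 \<and> \<theta> z = 0)"
    and g_eq: "\<And>z. z \<in> ball 0 1 \<Longrightarrow> g z = \<beta> z / \<theta> z"
    using assms(3) unfolding blaschke_quotients_def coprime_quotients_def by blast
  obtain q s b where q: "q \<le> \<kappa>" and s: "s \<in> schur_class" and b: "b \<in> blaschke_products q"
    and f_coprime: "\<And>z. z \<in> ball 0 1 \<Longrightarrow> \<not> (s z = 0 \<and> b z = 0)"
    and f_eq: "\<And>z. z \<in> ball 0 1 \<Longrightarrow> f z = s z / b z"
    using assms(4) unfolding gen_schur_class_le_def gen_schur_class_def coprime_quotients_def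
    by blast
  \<comment> \<open>Multiplying \<open>f - g\<close> by \<open>b * \<theta>\<close> removes both denominators.  Here \<open>\<theta>\<close> joins the Schur
    function and \<open>b\<close> the Blaschke product, whose degree becomes \<open>q + l\<close>.\<close>
  define B where "B = (\<lambda>z. b z * \<beta> z)"
  define h where "h = (\<lambda>z. s z * \<theta> z)"
  define m' where "m' = (\<lambda>p. m (inv_into {1..n} t p))"
  have m': "m' (t i) = m i" if "i \<in> {1..n}" for i
    using that assms(2) by (simp add: m'_def)
  have B: "B \<in> blaschke_products (q + l)"
    unfolding B_def using blaschke_product_mult[OF b \<beta>] .
  have h: "h \<in> schur_class"
    unfolding h_def by (rule schur_class_mult[OF s blaschke_product_schur[OF \<theta>]])
  have contact: "nontangential_smallo p (\<lambda>z. B z - h z) (\<lambda>z. (z - p) ^ m' p)"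
    if p: "p \<in> t ` {1..n}" for p
  proof -
    obtain i where i: "i \<in> {1..n}" "p = t i" using p by auto
    have np: "norm p = 1" using assms(1)[OF i(1)] i by simp
    obtain c D \<gamma> where D: "norm c = 1" "\<gamma> > 0"
      "\<And>z. norm z \<le> 1 \<Longrightarrow> \<gamma> \<le> norm (D z)"
      "\<And>z. norm z = 1 \<Longrightarrow> cnj (b z * \<theta> z) * cnj (D z) * z ^ (q + r) = c * D z"
      "continuous_on (cball 0 1) (\<lambda>z. b z * \<theta> z)"
      using blaschke_product_reflection[OF blaschke_product_mult[OF b \<theta>]] by metis
    have "b p * \<theta> p \<noteq> 0"
    proof
      assume "b p * \<theta> p = 0"
      then have "norm (c * D p) = 0" using D(4)[OF np] by (metis complex_cnj_zero mult_zero_left norm_zero)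
      then show False using D(1,2) D(3)[of p] np by (simp add: norm_mult)
    qed
    moreover have "((\<lambda>z. b z * \<theta> z) \<longlongrightarrow> b p * \<theta> p) (at p within cball 0 1)"
      using D(5) np by (auto simp: continuous_on_def)
    ultimately have nz: "\<forall>\<^sub>F z in at p within cball 0 1. b z * \<theta> z \<noteq> 0"
      by (metis tendsto_imp_eventually_ne)
    show ?thesis
      unfolding nontangential_smallo_def
    proof (intro allI impI)
      fix M :: real assume "M > 1"
      then have o: "(\<lambda>z. f z - g z) \<in> o[at p within stolz_angle p M](\<lambda>z. (z - p) ^ m' p)"
        using assms(5)[OF i(1)] i m' unfolding nontangential_smallo_def by auto
      have sub: "stolz_angle p M \<subseteq> ball 0 1" by (auto simp: stolz_angle_def)
      \<comment> \<open>At a zero of \<open>b * \<theta>\<close> the identity for \<open>B - h\<close> below can fail, since the quotients take the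
        value 0 there.\<close>
      have "\<forall>\<^sub>F z in at p within stolz_angle p M. b z * \<theta> z \<noteq> 0"
        by (rule filter_leD[OF at_le nz]) (use sub in auto)
      moreover have "\<forall>\<^sub>F z in at p within stolz_angle p M. z \<in> ball 0 1"
        unfolding eventually_at using sub by (auto intro!: exI[of _ 1])
      ultimately have "\<forall>\<^sub>F z in at p within stolz_angle p M.
          norm (B z - h z) \<le> norm (f z - g z)"
      proof eventually_elim
        case (elim z)
        have "B z - h z = - (b z * \<theta> z) * (f z - g z)"
          using elim f_eq[of z] g_eq[of z] by (simp add: B_def h_def field_simps)
        moreover have "norm (b z * \<theta> z) \<le> 1"
          using blaschke_product_schur[OF blaschke_product_mult[OF b \<theta>]] elim
          by (simp add: schur_class_def)
        ultimately show ?case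
          by (simp add: norm_mult mult_left_le_one_le)
      qed
      then have "(\<lambda>z. B z - h z) \<in> O[at p within stolz_angle p M](\<lambda>z. f z - g z)"
        by (intro landau_o.bigI[of 1]) auto
      then show "(\<lambda>z. B z - h z) \<in> o[at p within stolz_angle p M](\<lambda>z. (z - p) ^ m' p)"
        using o by (rule landau_o.big_small_trans)
    qed
  qed
  have "(\<Sum>p\<in>t ` {1..n}. (m' p + 1) div 2) = (\<Sum>i=1..n. (m i + 1) div 2)"
    unfolding sum.reindex[OF assms(2)] by (rule sum.cong) (simp_all only: m' o_apply)
  then have count: "q + l < (\<Sum>p\<in>t ` {1..n}. (m' p + 1) div 2)"
    using q assms(6) by linarith
  have hB: "h z = B z" if "z \<in> ball 0 1" for z
    by (rule schur_eq_blaschke_if_boundary_contact[OF _ _ h B contact count])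
       (use assms(1) that in auto)
  show ?thesis
  proof
    fix z :: complex assume z: "z \<in> ball 0 1"
    have eq: "s z * \<theta> z = b z * \<beta> z"
      using hB[OF z] by (simp add: h_def B_def)
    show "f z = g z"
    proof (cases "b z = 0 \<or> \<theta> z = 0")
      \<comment> \<open>Coprimality makes \<open>z\<close> a pole of both quotients, where both are 0 since \<open>x / 0 = 0\<close>.\<close>
      case True
      then have "b z = 0 \<and> \<theta> z = 0"
        using eq f_coprime[OF z] g_coprime[OF z] by auto
      then show ?thesis using f_eq[OF z] g_eq[OF z] by simp
    next
      case False
      then show ?thesis
        unfolding f_eq[OF z] g_eq[OF z] using eq by (simp add: frac_eq_eq mult.commute)
    qed
  qed
qed

end
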